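(* For an integer $n\geq 1$, let \[ V_{n}(x):=\frac{2(n+1)}{\binom{2n}{n}x^{n}(1-2x)}\left(Q_{n}(-x)^2-Q_{n-1}(-x)Q_{n+1}(-x)\right) \] (a polynomial in $x$). If $2n+1$ is prime, then $V_n(x)$ is irreducible over $\mathbb{Q}$.
   Context: For each integer $m\geq 0$, $P_m(x),Q_m(x)\in\mathbb{Q}[x]$ denote the unique pair of polynomials with $\deg P_m\leq m$, $\deg Q_m\leq m$ satisfying $P_m(x)x^{m+1}+Q_m(x)(x+1)^{m+1}=1$.
   Formalization: For n = 1 (2n+1 = 3 is prime) one has V_1(x) = 2, a nonzero constant and so a unit, not irreducible, over Q; the formal statement asserts V_1 = 2 in that case and irreducibility for all n ≥ 2 with 2n+1 prime. *)

theory Defs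
  imports
    "HOL-Computational_Algebra.Computational_Algebra"
    "HOL-Computational_Algebra.Field_as_Ring"
begin

definition is_bezout_pair :: "nat \<Rightarrow> rat poly \<Rightarrow> rat poly \<Rightarrow> bool" where
  "is_bezout_pair m P Q \<longleftrightarrow>
     degree P \<le> m \<and> degree Q \<le> m \<and> P * [:0, 1:] ^ (m + 1) + Q * [:1, 1:] ^ (m + 1) = 1"

lemma bezout_pair_ex1: "\<exists>!PQ. is_bezout_pair m (fst PQ) (snd PQ)"
proof -
  define X :: "rat poly" where "X = [:0, 1:] ^ (m + 1)"
  define Y :: "rat poly" where "Y = [:1, 1:] ^ (m + 1)"
  have dX: "degree X = m + 1" and dY: "degree Y = m + 1"
    unfolding X_def Y_def by (subst degree_power_eq; simp)+
  have X0: "X \<noteq> 0" using dX by auto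
  have "coprime [:0, 1:] ([:1, 1:] :: rat poly)"
  proof (rule coprimeI)
    fix c :: "rat poly" assume "c dvd [:0, 1:]" "c dvd [:1, 1:]"
    then have "c dvd [:1, 1:] - [:0, 1:]" by (rule dvd_diff[rotated])
    then show "is_unit c" by (simp add: one_pCons)
  qed
  then have cop: "coprime X Y"
    unfolding X_def Y_def coprime_power_left_iff coprime_power_right_iff by blast
  obtain a b where ab: "a * X + b * Y = 1"
    using bezout_coefficients_fst_snd[of X Y] coprime_imp_gcd_eq_1[OF cop] by simp
  define Q where "Q = b mod X"
  define P where "P = a + (b div X) * Y"
  have b: "b = (b div X) * X + Q" unfolding Q_def by simp
  have eq: "P * X + Q * Y = 1"
  proof -
    have "P * X + Q * Y = a * X + ((b div X) * X + Q) * Y"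
      unfolding P_def by (simp add: algebra_simps)
    then show ?thesis using ab by (simp only: b[symmetric])
  qed
  have dQ: "degree Q \<le> m"
    using degree_mod_less'[of X b] X0 dX unfolding Q_def by (cases "b mod X = 0") auto
  have dP: "degree P \<le> m"
  proof (cases "P = 0")
    case False
    have "P * X = 1 - Q * Y" using eq by (simp add: algebra_simps)
    moreover have "degree (1 - Q * Y) \<le> m + (m + 1)"
      by (rule degree_diff_le) (use degree_mult_le[of Q Y] dQ dY in auto)
    ultimately have "degree P + (m + 1) \<le> m + (m + 1)"
      using degree_mult_eq[OF False X0] dX by simp
    then show ?thesis by simp
  qed simp
  show ?thesis
  proof (rule ex1I[of _ "(P, Q)"])
    show "is_bezout_pair m (fst (P, Q)) (snd (P, Q))"
      using dP dQ eq by (simp add: is_bezout_pair_def X_def Y_def)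
  next
    fix R assume "is_bezout_pair m (fst R) (snd R)"
    then obtain P' Q' where R: "R = (P', Q')" and dQ': "degree Q' \<le> m"
      and eq': "P' * X + Q' * Y = 1"
      by (cases R) (auto simp: is_bezout_pair_def X_def Y_def)
    have e: "(P' - P) * X = (Q - Q') * Y"
    proof -
      have "(P' - P) * X - (Q - Q') * Y = (P' * X + Q' * Y) - (P * X + Q * Y)"
        by (simp add: algebra_simps)
      then show ?thesis using eq eq' by simp
    qed
    then have "X dvd (Q - Q') * Y" by (simp flip: e)
    then have "X dvd Q - Q'" using cop by (simp add: coprime_dvd_mult_left_iff)
    moreover have "degree (Q - Q') < degree X"
      using degree_diff_le[OF dQ dQ'] dX by simp
    ultimately have "Q - Q' = 0" using dvd_imp_degree_le[of X "Q - Q'"] by force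
    then show "R = (P, Q)" using e X0 R by simp
  qed
qed

definition bezout_pair :: "nat \<Rightarrow> rat poly \<times> rat poly" where
  "bezout_pair m = (THE PQ. is_bezout_pair m (fst PQ) (snd PQ))"

definition bezout_P :: "nat \<Rightarrow> rat poly" where "bezout_P m = fst (bezout_pair m)"

definition bezout_Q :: "nat \<Rightarrow> rat poly" where "bezout_Q m = snd (bezout_pair m)"

lemma is_bezout_pair_P_Q: "is_bezout_pair m (bezout_P m) (bezout_Q m)"
  unfolding bezout_P_def bezout_Q_def bezout_pair_def by (rule theI'[OF bezout_pair_ex1])

definition Q_neg :: "nat \<Rightarrow> rat poly" where
  "Q_neg m = pcompose (bezout_Q m) [:0, -1:]"

definition V_num :: "nat \<Rightarrow> rat poly" where
  "V_num n = smult (2 * (of_nat n + 1)) ((Q_neg n)\<^sup>2 - Q_neg (n - 1) * Q_neg (n + 1))"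

definition V_den :: "nat \<Rightarrow> rat poly" where
  "V_den n = smult (of_nat ((2 * n) choose n)) ([:0, 1:] ^ n * [:1, -2:])"

text \<open>Polynomial division; it agrees with the quotient of rational functions exactly when
  \<open>V_den n dvd V_num n\<close>.\<close>
definition V :: "nat \<Rightarrow> rat poly" where
  "V n = V_num n div V_den n"

end

theory Submission imports Defs begin

text \<open>
  Put \<open>q\<^sub>m(x) = \<Sum>k\<le>m. binom(m+k, k) x\<^sup>k\<close> and \<open>c\<^sub>m = binom(2m+1, m)\<close>. The recurrence
  \<open>(1-x) q\<^sub>m\<^sub>+\<^sub>1 = q\<^sub>m + c\<^sub>m x\<^bsup>m+1\<^esup> (1-2x)\<close> yields by induction the Bezout identity
  \<open>(1-x)\<^bsup>m+1\<^esup> q\<^sub>m(x) + x\<^bsup>m+1\<^esup> q\<^sub>m(1-x) = 1\<close>, so \<open>Q\<^sub>m(-x) = q\<^sub>m(x)\<close>. Eliminating \<open>q\<^sub>n\<^sub>+\<^sub>1\<close>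
  from \<open>q\<^sub>n\<^sup>2 - q\<^sub>n\<^sub>-\<^sub>1 q\<^sub>n\<^sub>+\<^sub>1\<close> gives
  \<open>(1-x) V\<^sub>n = (n+1) q\<^sub>n - 2(2n+1) x q\<^sub>n\<^sub>-\<^sub>1\<close>, whence \<open>V\<^sub>n\<close> is an integer polynomial of degree
  at most \<open>n-1\<close>, and differentiation at 1 gives \<open>(n+2) V\<^sub>n(1) = 2 c\<^sub>n\<close>.
  If \<open>p = 2n+1\<close> is prime, then \<open>-n-1 \<equiv> n\<close> modulo \<open>p\<close>, so \<open>q\<^sub>n \<equiv> (1-x)\<^sup>n\<close> and
  \<open>V\<^sub>n \<equiv> (n+1) (1-x)\<^bsup>n-1\<^esup>\<close>, while \<open>p\<close> divides \<open>V\<^sub>n(1)\<close> exactly once: Eisenstein's criterion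
  applies to \<open>V\<^sub>n(1-y)\<close>.
\<close>

section \<open>Integer polynomials viewed over a larger ring\<close>

lemma map_poly_of_int_pCons:
  "map_poly of_int (pCons a p) = (pCons (of_int a) (map_poly of_int p) :: 'a::ring_char_0 poly)"
  by (simp add: map_poly_pCons)

lemma map_poly_of_int_add:
  "map_poly of_int (p + q) = (map_poly of_int p + map_poly of_int q :: 'a::ring_char_0 poly)"
  by (rule poly_eqI) (simp add: coeff_map_poly)

lemma map_poly_of_int_diff:
  "map_poly of_int (p - q) = (map_poly of_int p - map_poly of_int q :: 'a::ring_char_0 poly)"
  by (rule poly_eqI) (simp add: coeff_map_poly)

lemma map_poly_of_int_smult:
  "map_poly of_int (smult c p) = (smult (of_int c) (map_poly of_int p) :: 'a::{comm_ring_1,ring_char_0} poly)"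
  by (rule poly_eqI) (simp add: coeff_map_poly)

lemma map_poly_of_int_mult:
  "map_poly of_int (p * q) =
    (map_poly of_int p * map_poly of_int q :: 'a::{comm_ring_1,ring_char_0} poly)"
  by (rule poly_eqI) (simp add: coeff_map_poly coeff_mult)

lemma map_poly_of_int_pcompose:
  "map_poly of_int (pcompose p q) =
    (pcompose (map_poly of_int p) (map_poly of_int q) :: 'a::{comm_ring_1,ring_char_0} poly)"
  by (induction p)
    (simp_all add: pcompose_pCons map_poly_of_int_pCons map_poly_of_int_add map_poly_of_int_mult)

lemma degree_map_poly_of_int:
  "degree (map_poly of_int p :: 'a::ring_char_0 poly) = degree p"
  by (cases "p = 0") (auto intro: map_poly_degree_eq)

lemma map_poly_of_int_inject:
  "(map_poly of_int p :: 'a::ring_char_0 poly) = map_poly of_int q \<longleftrightarrow> p = q"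
  by (auto simp: poly_eq_iff coeff_map_poly)

section \<open>Gauss's lemma\<close>

lemma rat_poly_clear_denominators:
  fixes a :: "rat poly"
  obtains d A where "d \<noteq> 0" "smult (of_int d) a = map_poly of_int A"
proof -
  have "\<exists>d A. d \<noteq> 0 \<and> smult (of_int d) a = map_poly of_int A"
  proof (induction a)
    case 0
    show ?case by (intro exI[of _ 1] exI[of _ 0]) simp
  next
    case (pCons c a)
    then obtain d A where d: "d \<noteq> 0" "smult (of_int d) a = map_poly of_int A" by blast
    obtain u v where c: "c = of_int u / of_int v" "v \<noteq> 0"
      by (metis Fract_of_int_quotient Rat_cases_nonzero less_numeral_extra(3) Rat_cases)
    have "smult (of_int (d * v)) (pCons c a) = map_poly of_int (pCons (d * u) (smult v A))"
      using c by (simp add: map_poly_of_int_pCons map_poly_of_int_smult flip: d(2))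
        (simp add: mult.commute)
    then show ?case using d c by (intro exI[of _ "d * v"]) auto
  qed
  then show ?thesis using that by blast
qed

text \<open>After clearing denominators, multiplicativity of the content shows that the product of
  the primitive parts is \<open>S\<close> up to its content and a sign; that constant is absorbed
  into the first factor.\<close>

lemma int_poly_factor_of_rat_factor:
  fixes S :: "int poly" and a b :: "rat poly"
  assumes "S \<noteq> 0" and S: "map_poly of_int S = a * b"
  obtains F G where "S = F * G" "degree F = degree a" "degree G = degree b"
proof -
  obtain d A where d: "d \<noteq> 0" "smult (of_int d) a = map_poly of_int A"
    by (rule rat_poly_clear_denominators)
  obtain e B where e: "e \<noteq> 0" "smult (of_int e) b = map_poly of_int B"
    by (rule rat_poly_clear_denominators)
  have "map_poly rat_of_int (smult (d * e) S) = map_poly of_int (A * B)"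
    by (simp add: map_poly_of_int_smult map_poly_of_int_mult S mult.commute[of "rat_of_int d"]
        flip: d(2) e(2))
  then have AB: "smult (d * e) S = A * B" by (simp only: map_poly_of_int_inject)
  define A' where "A' = primitive_part A"
  define B' where "B' = primitive_part B"
  have A: "A = smult (content A) A'" and B: "B = smult (content B) B'"
    by (simp_all add: A'_def B'_def)
  have "content (A * B) = content A * content B" by (rule content_mult)
  then have c: "normalize (d * e) * content S = content A * content B"
    by (simp flip: AB)
  \<comment> \<open>Contents are nonnegative, so \<open>c\<close> only sees the absolute value of
    \<open>d * e\<close>; \<open>u\<close> restores the sign.\<close>
  obtain u where u: "d * e = normalize (d * e) * u" "u * u = 1"
  proof
    show "d * e = normalize (d * e) * sgn (d * e)" by (simp add: abs_mult_sgn)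
    show "sgn (d * e) * sgn (d * e) = 1" using d e by (simp add: sgn_if)
  qed
  have "smult (d * e) S = smult (content A * content B) (A' * B')"
    by (subst AB, subst A, subst B) (simp add: mult.commute)
  also have "\<dots> = smult (d * e) (smult (u * content S) (A' * B'))"
    using c u by (metis (no_types, lifting) mult.assoc mult.commute mult_1 smult_smult)
  finally have "S = smult (u * content S) (A' * B')"
    using d e by (metis mult_eq_0_iff smult_cancel)
  then have "S = smult (u * content S) A' * B'" by simp
  moreover have "degree (smult (u * content S) A') = degree a"
  proof -
    have "degree A = degree a" using d by (metis degree_map_poly_of_int degree_smult_eq of_int_eq_0_iff)
    moreover have "u * content S \<noteq> 0" using u(2) assms(1) by auto
    ultimately show ?thesis by (simp add: A'_def)
  qed
  moreover have "degree B' = degree b"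
    using e by (metis degree_map_poly_of_int degree_smult_eq of_int_eq_0_iff B'_def degree_primitive_part)
  ultimately show ?thesis by (rule that)
qed

section \<open>Eisenstein's criterion and linear substitution\<close>

text \<open>Let i be least such that p does not divide \<open>coeff F i\<close>. Modulo p,
  coefficient i of \<open>F * G\<close> is \<open>coeff F i * coeff G 0\<close>, hence nonzero,
  although i \<le> \<open>degree F\<close> < \<open>degree (F * G)\<close>. So a factor whose
  constant term is prime to p has to be constant.\<close>

lemma eisenstein_int_aux:
  fixes F G :: "int poly" and p :: int
  assumes p: "prime p" and "degree G > 0"
    and lc: "\<not> p dvd lead_coeff (F * G)"
    and low: "\<And>i. i < degree (F * G) \<Longrightarrow> p dvd coeff (F * G) i"
    and G0: "\<not> p dvd coeff G 0"
  shows False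
proof -
  have nz: "F \<noteq> 0" "G \<noteq> 0" using lc by auto
  have "\<not> p dvd lead_coeff F" using lc by (auto simp: lead_coeff_mult)
  then have ex: "\<exists>i. \<not> p dvd coeff F i" by blast
  define i where "i = (LEAST i. \<not> p dvd coeff F i)"
  have i: "\<not> p dvd coeff F i" unfolding i_def by (rule LeastI_ex[OF ex])
  have less: "p dvd coeff F j" if "j < i" for j using not_less_Least that unfolding i_def by blast
  have "i \<le> degree F" using i by (metis dvd_0_right le_degree)
  then have "i < degree (F * G)" using nz assms(2) by (simp add: degree_mult_eq)
  then have "p dvd coeff (F * G) i" by (rule low)
  also have "coeff (F * G) i = coeff F i * coeff G 0 + (\<Sum>j<i. coeff F j * coeff G (i - j))"
    by (simp add: coeff_mult lessThan_Suc_atMost[symmetric])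
  finally have "p dvd coeff F i * coeff G 0 + (\<Sum>j<i. coeff F j * coeff G (i - j))" .
  moreover have "p dvd (\<Sum>j<i. coeff F j * coeff G (i - j))"
    by (rule dvd_sum) (simp add: less)
  ultimately have "p dvd coeff F i * coeff G 0" by (simp add: dvd_add_left_iff)
  then show False using i G0 p by (simp add: prime_dvd_mult_iff)
qed

lemma eisenstein_criterion_rat:
  fixes S :: "int poly" and p :: int
  assumes p: "prime p" and deg: "degree S > 0"
    and lc: "\<not> p dvd lead_coeff S"
    and low: "\<And>i. i < degree S \<Longrightarrow> p dvd coeff S i"
    and S0: "\<not> p\<^sup>2 dvd coeff S 0"
  shows "irreducible (map_poly rat_of_int S)"
proof (rule irreducibleI)
  have S: "S \<noteq> 0" using deg by auto
  then show nz: "map_poly rat_of_int S \<noteq> 0"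
    using map_poly_of_int_inject[of S 0, where 'a = rat] by simp
  show "\<not> map_poly rat_of_int S dvd 1"
    using nz deg by (simp add: is_unit_iff_degree degree_map_poly_of_int)
  fix a b :: "rat poly"
  assume ab: "map_poly rat_of_int S = a * b"
  then obtain F G where FG: "S = F * G" "degree F = degree a" "degree G = degree b"
    using int_poly_factor_of_rat_factor[OF S] by blast
  \<comment> \<open>At least one constant term is prime to p, and the auxiliary lemma forces that
    factor to be constant.\<close>
  have "\<not> p * p dvd coeff F 0 * coeff G 0" using S0 FG(1) by (simp add: coeff_mult power2_eq_square)
  then consider "\<not> p dvd coeff F 0" | "\<not> p dvd coeff G 0" using mult_dvd_mono by blast
  then have "degree F = 0 \<or> degree G = 0"
  proof cases
    case 1
    then show ?thesis
      using eisenstein_int_aux[OF p, of F G] lc low FG(1) by (auto simp: mult.commute)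
  next
    case 2
    then show ?thesis
      using eisenstein_int_aux[OF p, of G F] lc low FG(1) by auto
  qed
  then show "a dvd 1 \<or> b dvd 1"
    using FG nz ab by (auto simp: is_unit_iff_degree)
qed

text \<open>Composition with a polynomial of degree 1 is multiplicative and preserves degrees, so a
  factorization into nonunits would survive it.\<close>

lemma irreducible_of_pcompose_linear:
  fixes f g :: "'a::field poly"
  assumes "degree g = 1" "irreducible (pcompose f g)"
  shows "irreducible f"
proof (rule irreducibleI)
  show "f \<noteq> 0" using assms(2) by auto
  then show "\<not> f dvd 1"
    using assms by (auto simp: irreducible_def is_unit_iff_degree degree_pcompose)
  fix a b assume ab: "f = a * b"
  have "pcompose a g dvd 1 \<or> pcompose b g dvd 1"
    by (rule irreducibleD[OF assms(2)]) (simp add: ab pcompose_mult)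
  moreover have "a \<noteq> 0" "b \<noteq> 0" "pcompose a g \<noteq> 0" "pcompose b g \<noteq> 0"
    using assms(2) by (auto simp: ab pcompose_mult)
  ultimately show "a dvd 1 \<or> b dvd 1"
    using assms(1) by (simp add: is_unit_iff_degree degree_pcompose)
qed

section \<open>The explicit form of the Bezout polynomials\<close>

text \<open>The power series of (1-x)^(-m-1) cut off after x^m. The general coefficient ring serves
  both \<open>int\<close>, for congruences, and \<open>rat\<close>, for
  \<open>Q_neg\<close>.\<close>

definition trunc_neg_binomial :: "nat \<Rightarrow> 'a::comm_ring_1 poly" where
  "trunc_neg_binomial m = (\<Sum>k\<le>m. monom (of_nat ((m + k) choose k)) k)"

lemma coeff_trunc_neg_binomial:
  "coeff (trunc_neg_binomial m) k = (if k \<le> m then of_nat ((m + k) choose k) else 0)"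
  by (simp add: trunc_neg_binomial_def coeff_sum)

lemma degree_trunc_neg_binomial: "degree (trunc_neg_binomial m) \<le> m"
  by (rule degree_le) (simp add: coeff_trunc_neg_binomial)

lemma map_poly_trunc_neg_binomial:
  "map_poly of_int (trunc_neg_binomial m) = (trunc_neg_binomial m :: 'a::{comm_ring_1,ring_char_0} poly)"
  by (rule poly_eqI) (simp add: coeff_map_poly coeff_trunc_neg_binomial)

definition mid_binomial :: "nat \<Rightarrow> nat" where
  "mid_binomial m = (2 * m + 1) choose m"

lemma mid_binomial_altdef: "(2 * m + 1) choose (Suc m) = mid_binomial m"
  unfolding mid_binomial_def by (subst binomial_symmetric) auto

lemma central_binomial_Suc: "(2 * Suc m) choose (Suc m) = 2 * mid_binomial m"
proof -
  have "2 * Suc m = Suc (2 * m + 1)" by simp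
  then show ?thesis
    using mid_binomial_altdef[of m] mid_binomial_def[of m] by (simp only: binomial_Suc_Suc)
qed

lemma mid_binomial_central: "(m + 1) * mid_binomial m = (2 * m + 1) * ((2 * m) choose m)"
  using Suc_times_binomial[of m "2 * m"] mid_binomial_altdef[of m] by simp

lemma mid_binomial_Suc: "(m + 2) * mid_binomial (Suc m) = 2 * (2 * m + 3) * mid_binomial m"
proof -
  have "(Suc m + 1) * mid_binomial (Suc m) = (2 * Suc m + 1) * (2 * mid_binomial m)"
    unfolding mid_binomial_central central_binomial_Suc ..
  then show ?thesis by (simp add: algebra_simps)
qed

text \<open>Multiplication by 1-x takes differences of consecutive coefficients, so Pascal's rule
  gives the coefficients up to x^m. The truncation shows only at x^(m+1), with 2c - c = c, and at
  x^(m+2), with -2c, where c is \<open>mid_binomial m\<close>.\<close>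

lemma trunc_neg_binomial_Suc:
  "[:1, -1:] * trunc_neg_binomial (Suc m) =
    (trunc_neg_binomial m + smult (of_nat (mid_binomial m)) ([:0, 1:] ^ Suc m * [:1, -2:]) :: 'a::comm_ring_1 poly)"
proof (rule poly_eqI)
  fix k
  have mid: "(Suc m + Suc m) choose Suc m = 2 * mid_binomial m"
    unfolding central_binomial_Suc[symmetric] by (simp only: mult_2)
  have mid': "(Suc m + m) choose m = mid_binomial m" by (simp add: mid_binomial_def mult_2)
  have L: "coeff ([:1, -1:] * trunc_neg_binomial (Suc m)) k = (coeff (trunc_neg_binomial (Suc m)) k
      - (if k = 0 then 0 else coeff (trunc_neg_binomial (Suc m)) (k - 1)) :: 'a)"
    by (cases k) simp_all
  have R: "coeff (monom (of_nat (mid_binomial m)) (Suc m) * [:1, -2:]) k =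
      (if k = Suc m then of_nat (mid_binomial m)
       else if k = Suc (Suc m) then - 2 * of_nat (mid_binomial m) else 0 :: 'a)"
    by (simp add: coeff_monom_mult coeff_pCons split: nat.splits)
  consider "k = 0" | j where "k = Suc j" "k \<le> m" | "k = Suc m" | "k = Suc (Suc m)" | "k > Suc (Suc m)"
    by (metis not0_implies_Suc not_less_eq_eq le_SucE not_less)
  then have "coeff (trunc_neg_binomial (Suc m)) k
      - (if k = 0 then 0 else coeff (trunc_neg_binomial (Suc m)) (k - 1)) =
      (coeff (trunc_neg_binomial m) k + (if k = Suc m then of_nat (mid_binomial m)
       else if k = Suc (Suc m) then - 2 * of_nat (mid_binomial m) else 0) :: 'a)" (is ?thesis)
  proof cases
    case 3
    then show ?thesis
      by (simp add: coeff_trunc_neg_binomial mid mid' del: add_Suc add_Suc_right binomial_Suc_Suc)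
  next
    case 4
    then show ?thesis
      by (simp add: coeff_trunc_neg_binomial mid del: add_Suc add_Suc_right binomial_Suc_Suc)
  qed (simp_all add: coeff_trunc_neg_binomial)
  then show "coeff ([:1, -1:] * trunc_neg_binomial (Suc m)) k =
    (coeff (trunc_neg_binomial m +
      smult (of_nat (mid_binomial m)) ([:0, 1:] ^ Suc m * [:1, -2:])) k :: 'a)"
    unfolding coeff_add L mult_smult_left[symmetric] monom_altdef[symmetric] R .
qed

lemma pcompose_power: "pcompose (p ^ k) q = pcompose p q ^ k" for p q :: "'a::comm_ring_1 poly"
  by (induction k) (simp_all add: pcompose_1 pcompose_mult)

lemma trunc_neg_binomial_bezout:
  "[:1, -1:] ^ Suc m * trunc_neg_binomial m +
    [:0, 1:] ^ Suc m * pcompose (trunc_neg_binomial m) [:1, -1:] = (1 :: 'a::comm_ring_1 poly)"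
proof (induction m)
  case 0
  show ?case by (simp add: trunc_neg_binomial_def pcompose_1 one_pCons monom_0)
next
  case (Suc m)
  define X Y Z :: "'a poly" where "X = [:0, 1:]" and "Y = [:1, -1:]" and "Z = [:1, -2:]"
  define c :: 'a where "c = of_nat (mid_binomial m)"
  define q q' :: "'a poly" where "q = trunc_neg_binomial m" and "q' = trunc_neg_binomial (Suc m)"
  define r r' where "r = pcompose q Y" and "r' = pcompose q' Y"
  \<comment> \<open>Under x -> 1-x the factor 1-2x changes sign; hence the two correction terms
    cancel in the induction step.\<close>
  have XY: "pcompose Y Y = X" "pcompose X Y = Y" "pcompose Z Y = - Z"
    by (simp_all add: X_def Y_def Z_def pcompose_pCons)
  have q: "Y * q' = q + smult c (X ^ Suc m * Z)"
    unfolding X_def Y_def Z_def c_def q_def q'_def by (rule trunc_neg_binomial_Suc)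
  then have "pcompose (Y * q') Y = pcompose (q + smult c (X ^ Suc m * Z)) Y" by simp
  then have r: "X * r' = r - smult c (Y ^ Suc m * Z)"
    by (simp only: pcompose_mult pcompose_add pcompose_smult pcompose_power XY r_def r'_def) simp
  have "Y ^ Suc (Suc m) * q' + X ^ Suc (Suc m) * r' = Y ^ Suc m * (Y * q') + X ^ Suc m * (X * r')"
    by (simp add: mult_ac)
  also have "\<dots> = Y ^ Suc m * q + X ^ Suc m * r"
    unfolding q r by (simp add: algebra_simps)
  also have "\<dots> = 1" using Suc by (simp add: X_def Y_def q_def r_def)
  finally show ?case by (simp add: X_def Y_def q'_def r'_def)
qed

text \<open>Substituting -x in the explicit identity gives the defining one, with the sign of
  (-x)^(m+1) moved into \<open>P\<close>; uniqueness of the Bezout pair does the rest.\<close>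

lemma Q_neg_eq: "Q_neg m = trunc_neg_binomial m"
proof -
  define q :: "rat poly" where "q = trunc_neg_binomial m"
  define N :: "rat poly" where "N = [:0, -1:]"
  define P where "P = smult ((-1) ^ Suc m) (pcompose q [:1, 1:])"
  define Q where "Q = pcompose q N"
  have NN: "pcompose N N = [:0, 1:]" by (simp add: N_def pcompose_pCons)
  have q: "pcompose Q N = q" by (simp add: Q_def NN flip: pcompose_assoc)
  have "pcompose ([:1, -1:] ^ Suc m * q + [:0, 1:] ^ Suc m * pcompose q [:1, -1:]) N = 1"
    unfolding q_def trunc_neg_binomial_bezout by (rule pcompose_1)
  moreover have "N ^ Suc m = smult ((-1) ^ Suc m) ([:0, 1:] ^ Suc m)"
    by (simp add: N_def flip: smult_power)
  ultimately have "[:1, 1:] ^ Suc m * Q + smult ((-1) ^ Suc m) ([:0, 1:] ^ Suc m) * pcompose q [:1, 1:] = 1"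
    by (simp only: pcompose_add pcompose_mult pcompose_power flip: pcompose_assoc)
       (simp add: Q_def N_def pcompose_pCons)
  then have "P * [:0, 1:] ^ (m + 1) + Q * [:1, 1:] ^ (m + 1) = 1"
    by (simp add: P_def algebra_simps)
  moreover have "degree P \<le> m" "degree Q \<le> m"
    using degree_trunc_neg_binomial[of m, where 'a = rat]
    by (simp_all add: P_def Q_def N_def q_def degree_pcompose)
  ultimately have "is_bezout_pair m (fst (P, Q)) (snd (P, Q))" by (simp add: is_bezout_pair_def)
  moreover have "is_bezout_pair m (fst (bezout_P m, bezout_Q m)) (snd (bezout_P m, bezout_Q m))"
    using is_bezout_pair_P_Q by simp
  ultimately have "bezout_Q m = Q" using bezout_pair_ex1[of m] by blast
  then show ?thesis using q by (simp add: Q_neg_def q_def N_def)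
qed

section \<open>Values at 1 and the polynomial (1-x) V_n\<close>

lemma poly_trunc_neg_binomial_1:
  "poly (trunc_neg_binomial m) 1 = (of_nat (mid_binomial m) :: 'a::comm_ring_1)"
  using arg_cong[OF trunc_neg_binomial_Suc[of m], of "\<lambda>p. poly p (1 :: 'a)"] by simp

text \<open>In the derivative of the recurrence at 1, the left side reduces to -q_{m+1}(1), which
  the preceding lemma evaluates.\<close>

lemma poly_pderiv_trunc_neg_binomial_1:
  "poly (pderiv (trunc_neg_binomial m)) 1 =
    (of_nat ((m + 3) * mid_binomial m) - of_nat (mid_binomial (Suc m)) :: int)"
proof -
  have "poly (pderiv ([:1, -1:] * trunc_neg_binomial (Suc m))) (1 :: int) =
    poly (pderiv (trunc_neg_binomial m + smult (of_nat (mid_binomial m)) ([:0, 1:] ^ Suc m * [:1, -2:]))) 1"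
    by (simp only: trunc_neg_binomial_Suc)
  then show ?thesis
    by (simp add: pderiv_mult pderiv_add pderiv_smult pderiv_pCons pderiv_power_Suc
        poly_trunc_neg_binomial_1 del: power_Suc mult_pCons_left mult_pCons_right)
      (simp add: algebra_simps)
qed

text \<open>This is \<open>(1-x) V\<^sub>n\<close> for \<open>n = m + 1\<close>; the shift avoids truncated subtraction.\<close>
definition cofactor_poly :: "nat \<Rightarrow> 'a::comm_ring_1 poly" where
  "cofactor_poly m = smult (of_nat (m + 2)) (trunc_neg_binomial (Suc m))
    - smult (of_nat (2 * (2 * m + 3))) ([:0, 1:] * trunc_neg_binomial m)"

lemma V_num_cofactor: "[:1, -1:] * V_num (Suc m) = V_den (Suc m) * cofactor_poly m"
proof -
  define X Y Z :: "rat poly" where "X = [:0, 1:]" and "Y = [:1, -1:]" and "Z = [:1, -2:]"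
  define c c' :: rat where "c = of_nat (mid_binomial m)" and "c' = of_nat (mid_binomial (Suc m))"
  define q0 q1 q2 :: "rat poly" where "q0 = trunc_neg_binomial m"
    and "q1 = trunc_neg_binomial (Suc m)" and "q2 = trunc_neg_binomial (Suc (Suc m))"
  define k :: rat where "k = of_nat (m + 2)"
  define l :: rat where "l = of_nat (2 * (2 * m + 3))"
  have q1: "Y * q1 = q0 + smult c (X ^ Suc m * Z)"
    unfolding X_def Y_def Z_def c_def q0_def q1_def by (rule trunc_neg_binomial_Suc)
  have q2: "Y * q2 = q1 + smult c' (X ^ Suc (Suc m) * Z)"
    unfolding X_def Y_def Z_def c'_def q2_def q1_def by (rule trunc_neg_binomial_Suc)
  \<comment> \<open>This is what the factor n+1 in \<open>V_num\<close> is for: it turns the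
    coefficient \<open>c'\<close> into a multiple of \<open>c\<close>, so that \<open>c\<close> can
    be pulled out to match \<open>V_den\<close>.\<close>
  have kl: "k * c' = l * c"
    unfolding k_def l_def c_def c'_def by (simp only: mid_binomial_Suc flip: of_nat_mult)
  have "Y * (q1\<^sup>2 - q0 * q2) = (Y * q1) * q1 - q0 * (Y * q2)"
    by (simp add: algebra_simps power2_eq_square)
  also have "\<dots> = X ^ Suc m * Z * (smult c q1 - smult c' (X * q0))"
    unfolding q1 q2 by (simp add: algebra_simps)
  finally have "Y * smult (2 * k) (q1\<^sup>2 - q0 * q2) =
      smult 2 (X ^ Suc m * Z * smult k (smult c q1 - smult c' (X * q0)))"
    by simp
  also have "smult k (smult c q1 - smult c' (X * q0)) = smult c (smult k q1 - smult l (X * q0))"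
    using kl by (simp add: smult_diff_right mult.commute)
  finally have "Y * smult (2 * k) (q1\<^sup>2 - q0 * q2) =
      smult (2 * c) (X ^ Suc m * Z) * (smult k q1 - smult l (X * q0))"
    by simp
  moreover have "V_num (Suc m) = smult (2 * k) (q1\<^sup>2 - q0 * q2)"
    by (simp add: V_num_def Q_neg_eq q0_def q1_def q2_def k_def algebra_simps)
  moreover have "V_den (Suc m) = smult (2 * c) (X ^ Suc m * Z)"
    unfolding V_den_def central_binomial_Suc by (simp add: c_def X_def Z_def)
  moreover have "cofactor_poly m = smult k q1 - smult l (X * q0)"
    by (simp add: cofactor_poly_def k_def l_def q1_def q0_def X_def)
  ultimately show ?thesis by (simp add: Y_def)
qed

lemma map_poly_cofactor_poly:
  "map_poly of_int (cofactor_poly m) = (cofactor_poly m :: 'a::{comm_ring_1,ring_char_0} poly)"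
  by (simp add: cofactor_poly_def map_poly_of_int_diff map_poly_of_int_smult map_poly_of_int_mult
      map_poly_trunc_neg_binomial map_poly_of_int_pCons)

lemma degree_cofactor_poly: "degree (cofactor_poly m :: 'a::comm_ring_1 poly) \<le> Suc m"
proof -
  have "degree ([:0, 1:] * trunc_neg_binomial m :: 'a poly) \<le> Suc m"
    using degree_mult_le[of "[:0, 1:]" "trunc_neg_binomial m :: 'a poly"]
      degree_trunc_neg_binomial[of m, where 'a = 'a] by (simp add: degree_pCons_le)
  then show ?thesis unfolding cofactor_poly_def
    by (intro degree_diff_le order.trans[OF degree_smult_le] degree_trunc_neg_binomial)
qed

text \<open>The recursion for \<open>mid_binomial\<close> makes \<open>cofactor_poly m\<close>
  vanish at 1, so 1-x splits off over the integers. Since the derivative of (1-x) T at 1 is -T(1),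
  the value T(1) comes from the known derivatives.\<close>

lemma cofactor_poly_quotient:
  obtains T :: "int poly" where "cofactor_poly m = [:1, -1:] * T" "degree T \<le> m"
    "int (m + 3) * poly T 1 = 2 * int (mid_binomial (Suc m))"
proof -
  have rel: "int (m + 2) * int (mid_binomial (Suc m)) = int (2 * (2 * m + 3)) * int (mid_binomial m)" for m
    by (simp only: mid_binomial_Suc flip: of_nat_mult)
  have "poly (cofactor_poly m) (1 :: int) = 0"
    using rel[of m] by (simp add: cofactor_poly_def poly_trunc_neg_binomial_1)
  then have "[:- 1, 1:] dvd (cofactor_poly m :: int poly)" by (simp add: poly_eq_0_iff_dvd)
  then obtain T' :: "int poly" where "cofactor_poly m = [:- 1, 1:] * T'" by (rule dvdE)
  then have "cofactor_poly m = [:1, - 1:] * (- T')" by simp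
  then obtain T :: "int poly" where T: "cofactor_poly m = [:1, - 1:] * T" by blast
  have deg: "degree T \<le> m"
  proof (cases "T = 0")
    case False
    then have "degree (cofactor_poly m :: int poly) = Suc (degree T)"
      unfolding T by (subst degree_mult_eq) auto
    then show ?thesis using degree_cofactor_poly[of m, where 'a = int] by simp
  qed simp
  have "poly (pderiv (cofactor_poly m)) 1 = - poly T 1"
    unfolding T by (simp add: pderiv_mult pderiv_pCons del: mult_pCons_left)
  then have "- poly T 1 = int (m + 2) * poly (pderiv (trunc_neg_binomial (Suc m))) 1
      - int (2 * (2 * m + 3)) * (poly (trunc_neg_binomial m) 1 + poly (pderiv (trunc_neg_binomial m)) 1)"
    by (simp add: cofactor_poly_def pderiv_diff pderiv_smult pderiv_mult pderiv_pCons distrib_left)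
  also have "\<dots> = int (m + 2) * (int (m + 4) * int (mid_binomial (Suc m)) - int (mid_binomial (Suc (Suc m))))
      - int (2 * (2 * m + 3)) * (int (m + 4) * int (mid_binomial m) - int (mid_binomial (Suc m)))"
    unfolding poly_trunc_neg_binomial_1 poly_pderiv_trunc_neg_binomial_1 by (simp add: algebra_simps)
  finally have "- poly T 1 = \<dots>" .
  \<comment> \<open>Together with \<open>rel\<close> at m, this eliminates the two outer binomials
    and leaves only \<open>mid_binomial (Suc m)\<close>.\<close>
  moreover have "int (m + 3) * int (mid_binomial (Suc (Suc m))) = int (2 * (2 * m + 5)) * int (mid_binomial (Suc m))"
    using rel[of "Suc m"] by (simp only: add_Suc_right add_Suc mult_Suc_right numeral_eq_Suc) simp
  ultimately have "int (m + 3) * poly T 1 = 2 * int (mid_binomial (Suc m))"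
    using rel[of m] unfolding of_nat_add of_nat_mult of_nat_numeral by algebra
  with T deg show ?thesis by (rule that)
qed

section \<open>Reduction modulo the prime 2n+1 and irreducibility\<close>

text \<open>From k to k+1 the two terms get multiplied by (n+k+1)/(k+1) and -(n-k)/(k+1). These
  numerators differ by 2n+1, and k+1 \<le> n is invertible modulo the prime.\<close>

lemma trunc_neg_binomial_coeff_cong:
  assumes p: "prime (2 * n + 1)" and "k \<le> n"
  shows "int (2 * n + 1) dvd int ((n + k) choose k) - (-1) ^ k * int (n choose k)"
  using assms(2)
proof (induction k)
  case 0
  show ?case by simp
next
  case (Suc k)
  have "(n + Suc k) * ((n + k) choose k) = ((n + Suc k) choose Suc k) * Suc k"
    using Suc_times_binomial_eq[of "n + k" k] by simp
  then have 1: "int (Suc k) * int ((n + Suc k) choose Suc k) = int (n + Suc k) * int ((n + k) choose k)"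
    by (metis mult.commute of_nat_mult)
  have "Suc k * (n choose Suc k) = (n - k) * (n choose k)"
    using binomial_absorb_comp[of n k] binomial_absorption[of k n] by simp
  then have 2: "int (Suc k) * int (n choose Suc k) = (int n - int k) * int (n choose k)"
    using Suc.prems by (metis of_nat_diff of_nat_mult Suc_leD)
  have "int (Suc k) * (int ((n + Suc k) choose Suc k) - (-1) ^ Suc k * int (n choose Suc k)) =
    int (Suc k) * int ((n + Suc k) choose Suc k) + (-1) ^ k * (int (Suc k) * int (n choose Suc k))"
    by (simp add: algebra_simps)
  also have "\<dots> = int (n + Suc k) * (int ((n + k) choose k) - (-1) ^ k * int (n choose k))
      + int (2 * n + 1) * ((-1) ^ k * int (n choose k))"
    unfolding 1 2 by (simp add: algebra_simps)
  finally have "int (2 * n + 1) dvd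
      int (Suc k) * (int ((n + Suc k) choose Suc k) - (-1) ^ Suc k * int (n choose Suc k))"
    using Suc by simp
  moreover have "\<not> int (2 * n + 1) dvd int (Suc k)"
    using Suc.prems by (intro zdvd_not_zless) auto
  moreover have "prime (int (2 * n + 1))" using p by (simp only: prime_int_nat_transfer nat_int) simp
  ultimately show ?case using prime_dvd_mult_iff by blast
qed

text \<open>The divisibility makes \<open>V n\<close> the true quotient. The case n = 1 stands apart
  because the constant 2 is a unit of Q[x], hence not irreducible.\<close>

theorem theorem8p2:
  fixes n :: nat
  assumes "n \<ge> 1"
  shows "V_den n dvd V_num n \<and>
    (prime (2 * n + 1) \<longrightarrow> (if n = 1 then V n = [:2:] else irreducible (V n)))"
proof -
  obtain m where n: "n = Suc m" using assms by (cases n) auto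
  obtain T :: "int poly" where T: "cofactor_poly m = [:1, -1:] * T" "degree T \<le> m"
    "int (m + 3) * poly T 1 = 2 * int (mid_binomial (Suc m))"
    by (rule cofactor_poly_quotient)
  define W where "W = map_poly rat_of_int T"
  have "cofactor_poly m = [:1, -1:] * W"
    using arg_cong[OF T(1), of "map_poly rat_of_int"]
    by (simp only: map_poly_cofactor_poly map_poly_of_int_mult W_def) (simp add: map_poly_of_int_pCons)
  then have "[:1, -1:] * V_num n = [:1, -1:] * (V_den n * W)"
    using V_num_cofactor[of m] by (simp only: n mult_ac)
  then have num: "V_num n = V_den n * W" by (simp only: mult_cancel_left) simp
  have "V_den n \<noteq> 0" by (simp add: V_den_def del: mult_pCons_right)
  then have V: "V n = W" by (simp add: V_def num)
  have "V n = [:2:]" if "n = 1"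
  proof -
    have "T = [:poly T 1:]" using T(2) that n by (auto elim!: degree_eq_zeroE)
    moreover have "poly T 1 = 2" using T(3) that n by (simp add: mid_binomial_def)
    ultimately have "T = [:2:]" by metis
    then show ?thesis by (simp add: V W_def map_poly_of_int_pCons)
  qed
  moreover have "irreducible (V n)" if pr: "prime (2 * n + 1)" and "n \<noteq> 1"
  proof -
    define p where "p = int (2 * n + 1)"
    have p: "prime p" unfolding p_def using pr by (simp only: prime_int_nat_transfer nat_int) simp
    define Y :: "int poly" where "Y = [:1, -1:]"
    have "[:p:] dvd trunc_neg_binomial n - Y ^ n"
      unfolding const_poly_dvd_iff
    proof
      fix k
      have "coeff (Y ^ n) k = (-1) ^ k * int (n choose k)"
      proof (cases "k \<le> n")
        case True
        then show ?thesis by (simp add: Y_def coeff_linear_poly_power)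
      next
        case False
        then show ?thesis by (simp add: Y_def coeff_eq_0 degree_power_eq binomial_eq_0)
      qed
      then show "p dvd coeff (trunc_neg_binomial n - Y ^ n) k"
        using trunc_neg_binomial_coeff_cong[OF pr, of k]
        by (cases "k \<le> n") (simp_all add: coeff_trunc_neg_binomial p_def binomial_eq_0)
    qed
    \<comment> \<open>Since n = m+1, the coefficient 2(2m+3) in \<open>cofactor_poly m\<close> is
      2p, so its second term vanishes modulo p.\<close>
    then have "[:p:] dvd smult (int (n + 1)) (trunc_neg_binomial n - Y ^ n)
        - [:p:] * smult 2 ([:0, 1:] * trunc_neg_binomial m)"
      by (rule dvd_diff[OF dvd_smult dvd_triv_left])
    also have "\<dots> = cofactor_poly m - smult (int (n + 1)) (Y ^ n)"
      by (simp add: cofactor_poly_def n p_def smult_diff_right algebra_simps)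
    also have "\<dots> = Y * (T - smult (int (n + 1)) (Y ^ m))"
      by (simp add: T(1) Y_def n algebra_simps)
    finally have "[:p:] dvd Y * (T - smult (int (n + 1)) (Y ^ m))" .
    \<comment> \<open>As p stays prime in Z[x] and does not divide 1-x, the factor \<open>Y\<close>
      can be cancelled modulo p.\<close>
    moreover have "prime_elem [:p:]"
      using prime_imp_prime_elem[OF p] by (simp only: prime_elem_const_poly_iff)
    moreover have "\<not> [:p:] dvd Y"
    proof
      assume "[:p:] dvd Y"
      then have "p dvd coeff Y 0" by (simp only: const_poly_dvd_iff)
      then show False using p not_prime_unit by (auto simp only: Y_def coeff_pCons_0)
    qed
    ultimately have "[:p:] dvd T - smult (int (n + 1)) (Y ^ m)"
      using prime_elem_dvd_mult_iff by blast
    then obtain U where "T - smult (int (n + 1)) (Y ^ m) = [:p:] * U" by (rule dvdE)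
    then have U: "T = smult (int (n + 1)) (Y ^ m) + smult p U" by (simp add: algebra_simps)
    \<comment> \<open>The substitution x -> 1-x turns (n+1)(1-x)^m into (n+1)x^m, the shape modulo p
      that Eisenstein's criterion asks for.\<close>
    define S where "S = pcompose T Y"
    have "pcompose Y Y = [:0, 1:]" by (simp add: Y_def pcompose_pCons)
    then have "S = monom (int (n + 1)) m + smult p (pcompose U Y)"
      by (simp add: S_def U pcompose_add pcompose_smult pcompose_power monom_altdef)
    then have cS: "coeff S i = (if i = m then int (n + 1) else 0) + p * coeff (pcompose U Y) i" for i
      by simp
    have nd: "\<not> p dvd int (n + 1)" unfolding p_def using assms by (intro zdvd_not_zless) auto
    then have ndS: "\<not> p dvd coeff S m" by (simp add: cS dvd_add_left_iff)
    have degS: "degree S = m"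
    proof (rule antisym)
      show "degree S \<le> m" using T(2) by (simp add: S_def Y_def degree_pcompose)
      show "m \<le> degree S" using ndS by (metis dvd_0_right le_degree)
    qed
    \<comment> \<open>The multiple (n+1)(n+2) T(1) equals 2p binom(2n,n). A second factor p would
      divide 2 (2n)!, which is impossible for a prime p = 2n+1 > 2.\<close>
    have "\<not> p\<^sup>2 dvd poly T 1"
    proof
      assume "p\<^sup>2 dvd poly T 1"
      then have "p\<^sup>2 dvd int (n + 1) * (int (m + 3) * poly T 1)" by simp
      also have "int (n + 1) * (int (m + 3) * poly T 1) = 2 * (int (n + 1) * int (mid_binomial n))"
        unfolding T(3) n by simp
      also have "int (n + 1) * int (mid_binomial n) = p * int ((2 * n) choose n)"
        unfolding p_def by (simp only: mid_binomial_central flip: of_nat_mult)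
      finally have "p * p dvd p * (2 * int ((2 * n) choose n))"
        by (simp add: power2_eq_square mult_ac)
      then have "p dvd 2 * int ((2 * n) choose n)" using p by (simp only: dvd_mult_cancel_left) auto
      also have "2 * int ((2 * n) choose n) dvd 2 * (int ((2 * n) choose n) * (int (fact n) * int (fact n)))"
        by simp
      also have "\<dots> = 2 * int (fact (2 * n))"
        using arg_cong[OF binomial_fact_lemma[of n "2 * n"], of int] by (simp add: mult_ac)
      finally have "p dvd 2 * int (fact (2 * n))" .
      moreover have "\<not> p dvd 2" unfolding p_def using assms by (intro zdvd_not_zless) auto
      moreover have "\<not> p dvd int (fact (2 * n))"
        unfolding p_def int_dvd_int_iff using pr by (simp add: prime_dvd_fact_iff)
      ultimately show False using p prime_dvd_mult_iff by blast
    qed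
    moreover have "coeff S 0 = poly T 1" by (simp add: S_def Y_def poly_pcompose flip: poly_0_coeff_0)
    \<comment> \<open>Here n \<noteq> 1 enters: it makes the degree m = n-1 of \<open>S\<close>
      positive.\<close>
    ultimately have "irreducible (map_poly rat_of_int S)"
      using p ndS that n by (intro eisenstein_criterion_rat[of p]) (auto simp: degS cS)
    then have "irreducible (pcompose W [:1, -1:])"
      by (simp add: S_def W_def Y_def map_poly_of_int_pcompose map_poly_of_int_pCons)
    then show ?thesis
      unfolding V by (rule irreducible_of_pcompose_linear[of "[:1, -1:]", rotated]) simp
  qed
  ultimately show ?thesis by (auto simp: num)
qed

end
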